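(* Let $\mathscr{R}$ be a bipotent, divisible, archimedean, complete semifield. There is a $1:1$ order reversing correspondence $$\{\text{principal skeletons of }\mathscr{R}^n\}\leftrightarrow\{\text{principal kernels of }\langle\mathscr{R}\rangle\}$$ given by $Z\mapsto Ker_{\langle\mathscr{R}\rangle}(Z)$; the reverse map is given by $K\mapsto Skel(K)$.
   Context: Semifields are commutative, have no zero element and are not fields. Bipotent: $a+b\in\{a,b\}$; the order is $a\le b\iff a+b=b$. Divisible: every element has an $m$-th root for every $m\geq 1$. Archimedean: $a^k\le b$ for all $k\in\mathbb{Z}$ implies $a=1$. Complete: the underlying lattice is conditionally complete. The semifield $\mathscr{R}$ is (isomorphic to) $(\mathbb{R}_{>0},\max,\cdot)$. $\mathscr{R}(x_1,\dots,x_n)$ is the semifield of fractions of $\mathscr{R}[x_1,\dots,x_n]$, its elements being regarded as functions $\mathscr{R}^n\to\mathscr{R}$. A kernel of a semifield $\mathbb{S}$ is a multiplicative subgroup $K$ such that $xa+yb\in K$ whenever $a,b\in K$ and $x,y\in\mathbb{S}$ with $x+y=1$. $\langle A\rangle$ is the smallest kernel containing $A$; a kernel $\langle f\rangle$ generated by one element is principal. $\langle\mathscr{R}\rangle$ denotes the kernel of $\mathscr{R}(x_1,\dots,x_n)$ generated by any constant $\alpha\in\mathscr{R}\setminus\{1\}$ (independent of $\alpha$); it is itself a semifield, and its kernels are exactly the kernels of $\mathscr{R}(x_1,\dots,x_n)$ contained in it. $Skel(S)=\{a\in\mathscr{R}^n: f(a)=1\ \forall f\in S\}$. A principal skeleton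 is a set of the form $Skel(\{f\})$ with $f\in\mathscr{R}(x_1,\dots,x_n)$. For $Z\subseteq\mathscr{R}^n$, $Ker_{\langle\mathscr{R}\rangle}(Z)=\{f\in\langle\mathscr{R}\rangle: f(a)=1\ \forall a\in Z\}$. *)

theory Defs
  imports "HOL-Analysis.Finite_Cartesian_Product" "HOL-Library.Function_Division"
begin

section \<open>Semifields without zero\<close>

text \<open>
  Every element is invertible and there is no additive neutral element in the signature. A field
  is never an instance, since there \<open>inverse 0 * 0 = 0\<close>. The one-element semifield is an instance.
\<close>

class semifield = comm_semiring + comm_monoid_mult + inverse +
  assumes semifield_left_inverse: "inverse a * a = 1"
    and semifield_divide_inverse: "a / b = a * inverse b"

text \<open>
  The pointwise operations on functions make \<open>Fun(X, \<R>)\<close> a semifield; all semifields of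
  functions below are subsets of such a type, with the operations inherited from it.
\<close>

instance "fun" :: (type, semifield) semifield
  by standard (simp_all add: fun_eq_iff semifield_left_inverse semifield_divide_inverse)

class bipotent_semifield = semifield + order +
  assumes bipotent: "a + b = a \<or> a + b = b"
    and le_iff_add_eq: "a \<le> b \<longleftrightarrow> a + b = b"

class divisible_semifield = semifield +
  assumes ex_root: "m \<ge> 1 \<Longrightarrow> \<exists>b. b ^ m = a"

text \<open>
  The constant \<open>powi\<close> is not available in a class specification, so the powers with nonnegative
  and nonpositive exponents are listed separately.
\<close>

class archimedean_semifield = bipotent_semifield +
  assumes archimedean_nat: "(\<forall>k. a ^ k \<le> b) \<and> (\<forall>k. inverse a ^ k \<le> b) \<Longrightarrow> a = 1"

lemma archimedean:
  fixes a b :: "'a::archimedean_semifield"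
  assumes "\<forall>k::int. a powi k \<le> b"
  shows "a = 1"
proof (rule archimedean_nat[of a b], intro conjI allI)
  fix k :: nat
  show "a ^ k \<le> b"
    using assms[rule_format, of "int k"] by (simp add: power_int_def)
  have "inverse (1::'a) = 1"
    using semifield_left_inverse[of "1::'a"] by simp
  then show "inverse a ^ k \<le> b"
    using assms[rule_format, of "- int k"] by (cases "k = 0") (simp_all add: power_int_def)
qed


section \<open>Kernels\<close>

definition is_kernel :: "'b::semifield set \<Rightarrow> 'b set \<Rightarrow> bool" where
  "is_kernel S K \<longleftrightarrow>
     K \<subseteq> S \<and>
     1 \<in> K \<and> (\<forall>a\<in>K. \<forall>b\<in>K. a * b \<in> K) \<and> (\<forall>a\<in>K. inverse a \<in> K) \<and>
     (\<forall>a\<in>K. \<forall>b\<in>K. \<forall>x\<in>S. \<forall>y\<in>S. x + y = 1 \<longrightarrow> x * a + y * b \<in> K)"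

definition generated_kernel :: "'b::semifield set \<Rightarrow> 'b set \<Rightarrow> 'b set" where
  "generated_kernel S A = \<Inter>{K. is_kernel S K \<and> A \<subseteq> K}"

definition principal_kernels :: "'b::semifield set \<Rightarrow> 'b set set" where
  "principal_kernels S = {generated_kernel S {f} | f. f \<in> S}"


section \<open>Rational functions on \<open>\<R>\<^sup>n\<close>\<close>

text \<open>
  The set of functions \<open>\<R>\<^sup>n \<rightarrow> \<R>\<close> induced by \<open>\<R>[x\<^sub>1, \<dots>, x\<^sub>n]\<close>. As \<open>\<R>\<close> has no zero, these are the
  nonempty finite sums of monomials with coefficients in \<open>\<R>\<close>.
\<close>

inductive_set polynomial_funs :: "('r::semifield ^ 'n \<Rightarrow> 'r) set" where
  const: "(\<lambda>_. c) \<in> polynomial_funs"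
| var: "(\<lambda>v. v $ i) \<in> polynomial_funs"
| add: "p \<in> polynomial_funs \<Longrightarrow> q \<in> polynomial_funs \<Longrightarrow> p + q \<in> polynomial_funs"
| mult: "p \<in> polynomial_funs \<Longrightarrow> q \<in> polynomial_funs \<Longrightarrow> p * q \<in> polynomial_funs"

definition rational_funs :: "('r::semifield ^ 'n \<Rightarrow> 'r) set" where
  "rational_funs = {p / q | p q. p \<in> polynomial_funs \<and> q \<in> polynomial_funs}"

text \<open>
  \<open>\<langle>\<R>\<rangle>\<close>, as generated by the constant function \<open>\<alpha>\<close>. Meaningful only for \<open>\<alpha> \<noteq> 1\<close>; then it does
  not depend on \<open>\<alpha>\<close> if \<open>\<R>\<close> is bipotent, divisible, archimedean and complete.
\<close>

definition constant_kernel :: "'r::semifield \<Rightarrow> ('r ^ 'n \<Rightarrow> 'r) set" where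
  "constant_kernel \<alpha> = generated_kernel rational_funs {\<lambda>_. \<alpha>}"


section \<open>Skeletons\<close>

definition Skel :: "('r::semifield ^ 'n \<Rightarrow> 'r) set \<Rightarrow> ('r ^ 'n) set" where
  "Skel S = {a. \<forall>f\<in>S. f a = 1}"

definition principal_skeletons :: "('r::semifield ^ 'n) set set" where
  "principal_skeletons = {Skel {f} | f. f \<in> rational_funs}"

definition Ker :: "('r::semifield ^ 'n \<Rightarrow> 'r) set \<Rightarrow> ('r ^ 'n) set \<Rightarrow> ('r ^ 'n \<Rightarrow> 'r) set" where
  "Ker S Z = {f \<in> S. \<forall>a\<in>Z. f a = 1}"

end

theory Submission
  imports Defs
begin

text \<open>
  Writing \<open>\<bar>f\<bar> = f + f\<inverse>\<close>, the kernel generated by \<open>f\<close> consists of the \<open>g\<close> with \<open>\<bar>g\<bar> \<le> \<bar>f\<bar>\<^sup>k\<close> for some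
  \<open>k\<close>, so the heart of the matter is this: if \<open>f, g\<close> are rational, \<open>g\<close> is bounded and \<open>g = 1\<close> wherever
  \<open>f = 1\<close>, then \<open>\<bar>g\<bar> \<le> \<bar>f\<bar>\<^sup>k\<close>. On each of finitely many regions cut out by monomial inequalities,
  \<open>\<bar>f\<bar>\<close> and \<open>\<bar>g\<bar>\<close> are quotients of monomials, and Fourier--Motzkin elimination (which needs only roots
  and a total order) describes the set of pairs \<open>(s, t) = (\<bar>f\<bar> v, \<bar>g\<bar> v)\<close> by monomial inequalities. If
  \<open>s = 1\<close> occurs, then \<open>t = 1\<close> is forced there by a single inequality, which bounds \<open>t\<close> by a power of
  \<open>s\<close> throughout; otherwise \<open>s\<close> is bounded away from \<open>1\<close>, and since \<open>t\<close> is bounded the Archimedean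
  property applies. Finally, \<open>f\<close> and \<open>min \<bar>f\<bar> \<bar>\<alpha>\<bar>\<close> have the same skeleton, and the latter is in \<open>\<langle>\<R>\<rangle>\<close>.
\<close>

subsection \<open>Ordered arithmetic in bipotent semifields\<close>

lemma semifield_right_inverse: "a * inverse a = (1::'a::semifield)"
  by (metis mult.commute semifield_left_inverse)

lemma semifield_mult_left_cancel: "a * b = a * c \<longleftrightarrow> b = (c::'a::semifield)"
  by (metis mult.assoc mult_1 semifield_left_inverse)

lemma semifield_mult_right_cancel: "b * a = c * a \<longleftrightarrow> b = (c::'a::semifield)"
  by (metis mult.commute semifield_mult_left_cancel)

lemma semifield_inverse_unique: "a * b = 1 \<Longrightarrow> inverse a = (b::'a::semifield)"
  by (metis semifield_mult_left_cancel semifield_right_inverse)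

lemma semifield_inverse_one [simp]: "inverse 1 = (1::'a::semifield)"
  by (simp add: semifield_inverse_unique)

lemma semifield_inverse_inverse [simp]: "inverse (inverse a) = (a::'a::semifield)"
  by (simp add: semifield_inverse_unique semifield_left_inverse)

lemma semifield_inverse_mult: "inverse (a * b) = inverse a * inverse (b::'a::semifield)"
proof (rule semifield_inverse_unique)
  have "a * b * (inverse a * inverse b) = (a * inverse a) * (b * inverse b)"
    by (simp only: ac_simps)
  then show "a * b * (inverse a * inverse b) = 1"
    by (simp add: semifield_right_inverse)
qed

lemma semifield_inverse_power: "inverse (a ^ n) = inverse (a::'a::semifield) ^ n"
  by (induction n) (auto simp: semifield_inverse_mult)

lemma bipotent_total: "a \<le> b \<or> b \<le> (a::'a::bipotent_semifield)"
  by (metis add.commute bipotent le_iff_add_eq)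

lemma bipotent_not_le: "\<not> a \<le> b \<longleftrightarrow> b < (a::'a::bipotent_semifield)"
  using bipotent_total[of a b] by auto

lemma bipotent_add_idem [simp]: "a + a = (a::'a::bipotent_semifield)"
  using le_iff_add_eq by blast

lemma bipotent_add_le_iff: "a + b \<le> c \<longleftrightarrow> a \<le> c \<and> b \<le> (c::'a::bipotent_semifield)"
proof
  have "a \<le> a + b" "b \<le> a + b"
    by (simp_all add: le_iff_add_eq ac_simps flip: add.assoc)
  then show "a + b \<le> c \<Longrightarrow> a \<le> c \<and> b \<le> c" by auto
qed (metis bipotent)

lemma bipotent_le_add: "a \<le> a + b" "b \<le> a + (b::'a::bipotent_semifield)"
  using bipotent_add_le_iff by blast+

lemma bipotent_add_mono: "a \<le> b \<Longrightarrow> c \<le> d \<Longrightarrow> a + c \<le> b + (d::'a::bipotent_semifield)"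
  by (meson bipotent_add_le_iff bipotent_le_add order_trans)

lemma bipotent_mult_le_cancel_left [simp]:
  "a * b \<le> a * c \<longleftrightarrow> b \<le> (c::'a::bipotent_semifield)"
  by (metis distrib_left le_iff_add_eq semifield_mult_left_cancel)

lemma bipotent_mult_le_cancel_right [simp]:
  "b * a \<le> c * a \<longleftrightarrow> b \<le> (c::'a::bipotent_semifield)"
  by (metis mult.commute bipotent_mult_le_cancel_left)

lemma bipotent_mult_mono: "a \<le> b \<Longrightarrow> c \<le> d \<Longrightarrow> a * c \<le> b * (d::'a::bipotent_semifield)"
  by (meson bipotent_mult_le_cancel_left bipotent_mult_le_cancel_right order_trans)

lemma bipotent_power_mono: "a \<le> b \<Longrightarrow> a ^ n \<le> (b::'a::bipotent_semifield) ^ n"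
  by (induction n) (auto intro: bipotent_mult_mono)

lemma bipotent_one_le_power: "1 \<le> a \<Longrightarrow> 1 \<le> (a::'a::bipotent_semifield) ^ n"
  using bipotent_power_mono[of 1 a n] by simp

lemma bipotent_power_increasing:
  assumes "m \<le> n" "1 \<le> a" shows "a ^ m \<le> (a::'a::bipotent_semifield) ^ n"
proof -
  have "a ^ m * 1 \<le> a ^ m * a ^ (n - m)"
    using assms by (simp only: bipotent_mult_le_cancel_left bipotent_one_le_power)
  then show ?thesis using assms by (simp flip: power_add)
qed

lemma bipotent_le_power: "1 \<le> a \<Longrightarrow> 1 \<le> n \<Longrightarrow> a \<le> (a::'a::bipotent_semifield) ^ n"
  using bipotent_power_increasing[of 1 n a] by simp

text \<open>A totally ordered group is torsion-free: \<open>a\<close> and its positive powers lie on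
  the same side of \<open>1\<close>, and a positive power is at least as far from \<open>1\<close>
  as \<open>a\<close> is.\<close>

lemma bipotent_power_eq_one:
  assumes "1 \<le> n" "a ^ n = 1" shows "a = (1::'a::bipotent_semifield)"
proof (rule antisym)
  show "a \<le> 1"
    using bipotent_total[of 1 a] bipotent_le_power[of a n] assms by auto
  show "1 \<le> a"
  proof (rule ccontr)
    assume n: "\<not> 1 \<le> a"
    then have "a \<le> 1" using bipotent_total by blast
    have "a * a ^ (n - 1) \<le> a * 1"
      using bipotent_power_mono[OF \<open>a \<le> 1\<close>, of "n - 1"]
      by (simp only: bipotent_mult_le_cancel_left power_one)
    with assms n show False by (cases n) simp_all
  qed
qed

text \<open>If \<open>b \<le> a\<close> and \<open>a ^ n \<le> b ^ n\<close>, the two powers agree,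
  so \<open>a * inverse b\<close> is a root of \<open>1\<close>, hence \<open>1\<close>.\<close>

lemma bipotent_power_le_iff:
  assumes "1 \<le> n" shows "a ^ n \<le> b ^ n \<longleftrightarrow> a \<le> (b::'a::bipotent_semifield)"
proof
  assume *: "a ^ n \<le> b ^ n"
  show "a \<le> b"
  proof (rule ccontr)
    assume n: "\<not> a \<le> b"
    then have "b \<le> a" using bipotent_total by blast
    then have "a ^ n = b ^ n" using * bipotent_power_mono by (metis antisym)
    then have "(a * inverse b) ^ n = 1"
      by (simp add: power_mult_distrib semifield_right_inverse flip: semifield_inverse_power)
    then have "a * inverse b = 1" using assms bipotent_power_eq_one by blast
    then have "a = b" by (metis semifield_inverse_inverse semifield_inverse_unique mult.commute)
    with n show False by simp
  qed
qed (rule bipotent_power_mono)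

lemma bipotent_inverse_le_iff: "inverse a \<le> inverse b \<longleftrightarrow> b \<le> (a::'a::bipotent_semifield)"
proof -
  have "inverse a \<le> inverse b \<longleftrightarrow> a * b * inverse a \<le> a * b * inverse b"
    by simp
  also have "a * b * inverse a = b"
    by (metis mult.assoc mult.commute mult_1_right semifield_left_inverse)
  also have "a * b * inverse b = a"
    by (simp add: mult.assoc semifield_right_inverse)
  finally show ?thesis .
qed

lemma bipotent_mult_inverse_le_iff: "v * inverse u \<le> w \<longleftrightarrow> v \<le> w * (u::'a::bipotent_semifield)"
  using bipotent_mult_le_cancel_right[of "v * inverse u" u w]
  by (simp add: mult.assoc semifield_left_inverse)

lemma bipotent_le_mult_inverse_iff: "w \<le> v * inverse u \<longleftrightarrow> w * u \<le> (v::'a::bipotent_semifield)"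
  using bipotent_mult_le_cancel_right[of w u "v * inverse u"]
  by (simp add: mult.assoc semifield_left_inverse)

text \<open>If all powers of \<open>a\<close> stayed below \<open>b\<close>, so would those of
  \<open>inverse a\<close>, which are at most \<open>1 = a ^ 0\<close>; the archimedean axiom would
  then give \<open>a = 1\<close>.\<close>

lemma archimedean_ex_power_ge:
  assumes "1 < (a::'a::archimedean_semifield)" shows "\<exists>k. b \<le> a ^ k"
proof (rule ccontr)
  assume "\<nexists>k. b \<le> a ^ k"
  then have *: "a ^ k \<le> b" for k using bipotent_total by blast
  have "inverse a \<le> 1" using assms bipotent_inverse_le_iff[of a 1] by simp
  then have "inverse a ^ k \<le> b" for k
    using bipotent_power_mono[of "inverse a" 1 k] *[of 0] by (simp add: order_trans)
  with * have "a = 1" by (intro archimedean_nat[of a b]) blast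
  with assms show False by simp
qed

lemma bipotent_finite_has_min:
  assumes "finite A" "A \<noteq> {}" shows "\<exists>m\<in>A. \<forall>a\<in>A. m \<le> (a::'a::bipotent_semifield)"
proof -
  obtain m where "m \<in> A" "\<And>a. a \<in> A \<Longrightarrow> a \<le> m \<Longrightarrow> m = a"
    using finite_has_minimal[OF assms] by blast
  then show ?thesis using bipotent_total[of m] by (intro bexI[of _ m]) auto
qed

lemma bipotent_finite_has_max:
  assumes "finite A" "A \<noteq> {}" shows "\<exists>m\<in>A. \<forall>a\<in>A. (a::'a::bipotent_semifield) \<le> m"
proof -
  obtain m where "m \<in> A" "\<And>a. a \<in> A \<Longrightarrow> m \<le> a \<Longrightarrow> m = a"
    using finite_has_maximal[OF assms] by blast
  then show ?thesis using bipotent_total[of m] by (intro bexI[of _ m]) auto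
qed

text \<open>A largest element of \<open>L\<close> works, or a smallest one of \<open>U\<close> when
  \<open>L\<close> is empty. In the elimination below, this picks a value between the lower and the
  upper bounds on a variable.\<close>

lemma bipotent_finite_between:
  fixes L U :: "'a::bipotent_semifield set"
  assumes "finite L" "finite U" "\<forall>l\<in>L. \<forall>u\<in>U. l \<le> u"
  shows "\<exists>y. (\<forall>l\<in>L. l \<le> y) \<and> (\<forall>u\<in>U. y \<le> u)"
proof (cases "L = {}")
  case True
  show ?thesis
  proof (cases "U = {}")
    case False
    then obtain m where "m \<in> U" "\<forall>u\<in>U. m \<le> u"
      using bipotent_finite_has_min[OF assms(2)] by metis
    with True show ?thesis by auto
  qed (use True in auto)
next
  case False
  then obtain m where "m \<in> L" "\<forall>l\<in>L. l \<le> m"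
    using bipotent_finite_has_max[OF assms(1)] by metis
  with assms(3) show ?thesis by (intro exI[of _ m]) simp
qed

subsection \<open>Absolute values and generated kernels\<close>

definition absv :: "'a::semifield \<Rightarrow> 'a" where
  "absv a = a + inverse a"

text \<open>The lower bound \<open>inverse h \<le> a\<close> is written without an inverse, so that
  bounds can be multiplied and added directly.\<close>

lemma absv_le_iff: "absv a \<le> h \<longleftrightarrow> a \<le> h \<and> 1 \<le> a * (h::'a::bipotent_semifield)"
  using bipotent_mult_inverse_le_iff[of 1 a h]
  by (simp add: absv_def bipotent_add_le_iff mult.commute)

lemma one_le_absv: "1 \<le> absv (a::'a::bipotent_semifield)"
proof -
  have "1 \<le> a \<or> 1 \<le> inverse a"
    using bipotent_total[of 1 a] bipotent_inverse_le_iff[of 1 a] by auto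
  then show ?thesis
    unfolding absv_def
    using order_trans[OF _ bipotent_le_add(1), of 1 a "inverse a"]
      order_trans[OF _ bipotent_le_add(2), of 1 "inverse a" a] by blast
qed

lemma absv_eq_one_iff: "absv a = 1 \<longleftrightarrow> a = (1::'a::bipotent_semifield)"
proof
  assume "absv a = 1"
  then have "a \<le> 1 \<and> 1 \<le> a" using absv_le_iff[of a 1] by simp
  then show "a = 1" by (simp add: antisym)
qed (simp add: absv_def)

lemma absv_le_one_iff: "absv a \<le> 1 \<longleftrightarrow> a = (1::'a::bipotent_semifield)"
  using one_le_absv[of a] absv_eq_one_iff[of a] by auto

lemma one_less_absv: "a \<noteq> 1 \<Longrightarrow> 1 < absv (a::'a::bipotent_semifield)"
  using one_le_absv[of a] absv_eq_one_iff[of a] by (auto simp: order_less_le)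

lemma absv_inverse: "absv (inverse a) = absv (a::'a::semifield)"
  by (simp add: absv_def add.commute)

lemma absv_mult_le:
  assumes "absv a \<le> h" "absv b \<le> k" shows "absv (a * b) \<le> h * (k::'a::bipotent_semifield)"
proof -
  have "a * b \<le> h * k" "1 \<le> (a * h) * (b * k)"
    using assms bipotent_mult_mono[of a h b k] bipotent_mult_mono[of 1 "a * h" 1 "b * k"]
    by (simp_all add: absv_le_iff)
  then show ?thesis by (simp add: absv_le_iff ac_simps)
qed

text \<open>The upper bound uses \<open>x * h + y * h = h\<close>; the lower one compares
  \<open>1 = x + y\<close> with \<open>(x * a + y * b) * h\<close> term by term.\<close>

lemma absv_convex_le:
  assumes "absv a \<le> h" "absv b \<le> h" "x + y = 1"
  shows "absv (x * a + y * b) \<le> (h::'a::bipotent_semifield)"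
proof -
  have "x * a + y * b \<le> x * h + y * h"
    using assms(1,2) by (simp add: absv_le_iff bipotent_add_mono)
  moreover have "x * h + y * h = h"
    using assms(3) by (simp flip: distrib_right)
  moreover have "x * 1 + y * 1 \<le> x * (a * h) + y * (b * h)"
    using assms(1,2) unfolding absv_le_iff
    by (intro bipotent_add_mono) (simp_all only: bipotent_mult_le_cancel_left)
  moreover have "x * (a * h) + y * (b * h) = (x * a + y * b) * h"
    by (simp add: distrib_right mult.assoc)
  ultimately show ?thesis
    using assms(3) by (simp add: absv_le_iff)
qed

section \<open>Kernels generated by a single function\<close>

definition is_subsemifield :: "'b::semifield set \<Rightarrow> bool" where
  "is_subsemifield S \<longleftrightarrow> 1 \<in> S \<and> (\<forall>a\<in>S. \<forall>b\<in>S. a + b \<in> S \<and> a * b \<in> S) \<and> (\<forall>a\<in>S. inverse a \<in> S)"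

text \<open>Bounds multiply, so exponents add under products. For a convex combination, both bounds
  are first raised to the common exponent \<open>k + l\<close>.\<close>

lemma is_kernel_absv_bounded:
  fixes f :: "'x \<Rightarrow> 'r::bipotent_semifield"
  assumes "is_subsemifield S"
  shows "is_kernel S {g \<in> S. \<exists>k. \<forall>x. absv (g x) \<le> absv (f x) ^ k}"
    (is "is_kernel S ?K")
  unfolding is_kernel_def
proof (intro conjI ballI impI)
  show "?K \<subseteq> S" by auto
  show "1 \<in> ?K"
    using assms by (auto simp: is_subsemifield_def absv_def intro!: exI[of _ 0])
next
  fix a b assume ab: "a \<in> ?K" "b \<in> ?K"
  then obtain k l where kl: "\<And>x. absv (a x) \<le> absv (f x) ^ k" "\<And>x. absv (b x) \<le> absv (f x) ^ l"
    by auto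
  from absv_mult_le[OF kl] have "absv ((a * b) x) \<le> absv (f x) ^ (k + l)" for x
    by (simp add: power_add)
  with ab assms show "a * b \<in> ?K" unfolding is_subsemifield_def by blast
  fix x y assume xy: "x \<in> S" "y \<in> S" "x + y = 1"
  have "absv (a z) \<le> absv (f z) ^ (k + l)" "absv (b z) \<le> absv (f z) ^ (k + l)" for z
    by (rule order_trans[OF kl(1)] order_trans[OF kl(2)],
        simp add: bipotent_power_increasing one_le_absv)+
  moreover have "x z + y z = 1" for z using fun_cong[OF xy(3)] by simp
  ultimately have "absv ((x * a + y * b) z) \<le> absv (f z) ^ (k + l)" for z
    by (simp add: absv_convex_le)
  moreover have "x * a + y * b \<in> S" using xy ab assms by (simp add: is_subsemifield_def)
  ultimately show "x * a + y * b \<in> ?K" by blast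
next
  fix a assume "a \<in> ?K"
  with assms show "inverse a \<in> ?K" by (simp add: is_subsemifield_def absv_inverse)
qed

text \<open>The set on the right is a kernel containing \<open>f\<close>. Conversely, a kernel
  containing \<open>f\<close> contains the power \<open>h\<close> of its absolute value, and any
  \<open>g\<close> in \<open>S\<close> between \<open>inverse h\<close> and \<open>h\<close> is
  recovered by one convex combination and a division by \<open>h\<close>.\<close>

lemma generated_kernel_singleton:
  fixes f :: "'x \<Rightarrow> 'r::bipotent_semifield"
  assumes S: "is_subsemifield S" and f: "f \<in> S"
  shows "generated_kernel S {f} = {g \<in> S. \<exists>k. \<forall>x. absv (g x) \<le> absv (f x) ^ k}"
    (is "_ = ?K")
proof (rule antisym)
  have "f \<in> ?K" using f by (auto intro: exI[of _ 1])
  with is_kernel_absv_bounded[OF S] show "generated_kernel S {f} \<subseteq> ?K"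
    unfolding generated_kernel_def by (intro Inter_lower) blast
next
  show "?K \<subseteq> generated_kernel S {f}"
    unfolding generated_kernel_def
  proof (intro subsetI InterI)
    fix g K assume g: "g \<in> ?K" and "K \<in> {K. is_kernel S K \<and> {f} \<subseteq> K}"
    then have K: "is_kernel S K" and fK: "f \<in> K" by auto
    from g obtain k where gS: "g \<in> S" and k: "\<And>x. absv (g x) \<le> absv (f x) ^ k" by auto
    have one: "(1::'x \<Rightarrow> 'r) + 1 = 1" by (simp add: fun_eq_iff)
    have [simp]: "1 \<in> S" using S by (simp add: is_subsemifield_def)
    \<comment> \<open>Since \<open>1 + 1 = 1\<close>, the pair \<open>1\<close>, \<open>1\<close>
      consists of admissible weights, so the absolute value of \<open>f\<close> lies in
      \<open>K\<close>.\<close>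
    have "1 * f + 1 * inverse f \<in> K"
      using K fK one \<open>1 \<in> S\<close> unfolding is_kernel_def by blast
    then have "(absv \<circ> f) \<in> K" by (simp add: absv_def fun_eq_iff comp_def plus_fun_def)
    moreover have mK: "a * b \<in> K" if "a \<in> K" "b \<in> K" for a b
      using that K by (simp add: is_kernel_def)
    moreover have "1 \<in> K" using K by (simp add: is_kernel_def)
    ultimately have hK: "(absv \<circ> f) ^ n \<in> K" for n by (induction n) auto
    define h where "h = (absv \<circ> f) ^ k"
    have pw: "(u ^ n) x = u x ^ n" for u :: "'x \<Rightarrow> 'r" and n x by (induction n) auto
    have gh: "g x \<le> h x" "1 \<le> g x * h x" for x
      using k[of x] by (simp_all add: h_def pw absv_le_iff)
    have hK: "h \<in> K" using hK h_def by simp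
    then have hhK: "h * h \<in> K" using mK by simp
    \<comment> \<open>As \<open>g \<le> h\<close>, this weight satisfies \<open>1 + ?y = 1\<close>.
      Combining \<open>1\<close> and \<open>h * h\<close> gives \<open>1 + g * h\<close>, which is
      \<open>g * h\<close> because \<open>1 \<le> g * h\<close>.\<close>
    let ?y = "g * inverse h"
    have "h \<in> S" using hK K by (auto simp: is_kernel_def)
    then have "?y \<in> S" using gS S by (simp add: is_subsemifield_def)
    moreover have "1 + ?y = 1"
      using gh(1) bipotent_mult_inverse_le_iff[of "g _" "h _" 1]
      by (simp add: fun_eq_iff add.commute[of 1] flip: le_iff_add_eq)
    ultimately have "1 * 1 + ?y * (h * h) \<in> K"
      using K hhK \<open>1 \<in> K\<close> \<open>1 \<in> S\<close> unfolding is_kernel_def by blast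
    moreover have "g x * inverse (h x) * (h x * h x) = g x * h x" for x
      by (metis mult.assoc mult.left_commute mult_1 semifield_left_inverse)
    then have "1 * 1 + ?y * (h * h) = g * h"
      using gh(2) by (simp add: fun_eq_iff le_iff_add_eq)
    moreover have "inverse h \<in> K" using hK K by (simp add: is_kernel_def)
    ultimately have "g * h * inverse h \<in> K" using mK by metis
    then show "g \<in> K" by (simp add: mult.assoc semifield_right_inverse)
  qed
qed

subsection \<open>Fourier--Motzkin elimination for monomial inequalities\<close>

text \<open>\<open>V\<close> records which variables may occur. Exponents are nonnegative; negative
  powers are moved to the other side of an inequality.\<close>

inductive_set monomials :: "'i set \<Rightarrow> (('i \<Rightarrow> 'r::semifield) \<Rightarrow> 'r) set" for V where
  const: "(\<lambda>_. c) \<in> monomials V"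
| var: "i \<in> V \<Longrightarrow> (\<lambda>x. x i) \<in> monomials V"
| mult: "p \<in> monomials V \<Longrightarrow> q \<in> monomials V \<Longrightarrow> (\<lambda>x. p x * q x) \<in> monomials V"

lemma monomials_power: "p \<in> monomials V \<Longrightarrow> (\<lambda>x. p x ^ n) \<in> monomials V"
  by (induction n) (auto intro: monomials.intros)

lemma monomials_mono:
  assumes "p \<in> monomials V" "V \<subseteq> W" shows "p \<in> monomials W"
  using assms(1) by induction (use assms(2) in \<open>auto intro: monomials.intros\<close>)

lemma monomials_cong:
  assumes "p \<in> monomials V" "\<And>i. i \<in> V \<Longrightarrow> x i = y i" shows "p x = p y"
  using assms(1) by induction (use assms(2) in auto)

lemma monomials_insert:
  assumes "p \<in> monomials (insert i V)"
  shows "\<exists>a. \<exists>u\<in>monomials V. \<forall>x. p x = x i ^ a * u x"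
  using assms
proof induction
  case (const c)
  show ?case by (rule exI[of _ 0]) (auto intro!: bexI[of _ "\<lambda>_. c"] monomials.const)
next
  case (var j)
  show ?case
  proof (cases "j = i")
    case True
    then show ?thesis by (intro exI[of _ 1] bexI[of _ "\<lambda>_. 1"]) (auto intro: monomials.const)
  next
    case False
    with var have "j \<in> V" by simp
    then show ?thesis
      by (intro exI[of _ 0] bexI[of _ "\<lambda>x. x j"]) (auto intro: monomials.var)
  qed
next
  case (mult p q)
  then obtain a u b v where "u \<in> monomials V" "v \<in> monomials V"
    "\<forall>x. p x = x i ^ a * u x" "\<forall>x. q x = x i ^ b * v x" by blast
  then show ?case
    by (intro exI[of _ "a + b"] bexI[of _ "\<lambda>x. u x * v x"])
      (simp_all add: power_add ac_simps monomials.mult)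
qed

text \<open>The value at the all-ones point is the coefficient, since powers of \<open>1\<close>
  drop out.\<close>

lemma monomials_singleton:
  assumes "p \<in> monomials {i}"
  shows "\<exists>a. \<forall>x. p x = x i ^ a * p (\<lambda>_. 1)"
proof -
  obtain a u where u: "u \<in> monomials {}" "\<forall>x. p x = x i ^ a * u x"
    using monomials_insert[OF assms] by blast
  have "p x = x i ^ a * p (\<lambda>_. 1)" for x
    using u(2) monomials_cong[OF u(1), of x "\<lambda>_. 1"] by simp
  then show ?thesis by blast
qed

section \<open>Systems of monomial inequalities, sorted by one variable\<close>

type_synonym ('i, 'r) inequality = "(('i \<Rightarrow> 'r) \<Rightarrow> 'r) \<times> (('i \<Rightarrow> 'r) \<Rightarrow> 'r)"

definition sols :: "('i, 'r::ord) inequality set \<Rightarrow> ('i \<Rightarrow> 'r) set" where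
  "sols C = {x. \<forall>(p, q)\<in>C. p x \<le> q x}"

lemma sols_cong:
  assumes "C \<subseteq> monomials V \<times> monomials V" "\<And>i. i \<in> V \<Longrightarrow> x i = y i" "x \<in> sols C"
  shows "y \<in> sols C"
proof -
  have "p y \<le> q y" if "(p, q) \<in> C" for p q
  proof -
    have "p \<in> monomials V" "q \<in> monomials V" using that assms(1) by auto
    then have "p x = p y" "q x = q y" using monomials_cong assms(2) by metis+
    moreover have "p x \<le> q x" using assms(3) that by (auto simp: sols_def)
    ultimately show ?thesis by simp
  qed
  then show ?thesis by (auto simp: sols_def)
qed

text \<open>Cancelling the smaller power of \<open>y\<close> leaves \<open>y\<close> on one side
  only; for \<open>a = b\<close> the remaining exponent is \<open>0\<close>.\<close>

lemma bipotent_power_mult_le_normal_form: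
  fixes y :: "'r::bipotent_semifield"
  shows "y ^ a * u \<le> y ^ b * v \<longleftrightarrow>
    (if a < b then u \<le> y ^ (b - a) * v else y ^ (a - b) * u \<le> v)"
proof (cases "a < b")
  case True
  then have "y ^ b * v = y ^ a * (y ^ (b - a) * v)"
    by (simp flip: power_add mult.assoc)
  with True show ?thesis by simp
next
  case False
  then have "y ^ a * u = y ^ b * (y ^ (a - b) * u)"
    by (simp flip: power_add mult.assoc)
  with False show ?thesis by simp
qed

text \<open>For \<open>i \<notin> V\<close>, \<open>U\<close> holds upper bounds on
  \<open>x i\<close>, \<open>L\<close> lower bounds, and \<open>N\<close> the inequalities free of
  \<open>x i\<close>. Exponents start at \<open>1\<close>, so that the bounds can be solved for
  \<open>x i\<close> by taking roots.\<close>

definition solved_form where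
  "solved_form i V C U L N \<longleftrightarrow> finite U \<and> finite L \<and> finite N \<and>
    U \<subseteq> {1..} \<times> monomials V \<times> monomials V \<and> L \<subseteq> {1..} \<times> monomials V \<times> monomials V \<and>
    N \<subseteq> monomials V \<times> monomials V \<and>
    (\<forall>x. x \<in> sols C \<longleftrightarrow> (\<forall>(d :: nat, u, v)\<in>U. x i ^ d * u x \<le> v x) \<and>
       (\<forall>(d :: nat, u, v)\<in>L. u x \<le> x i ^ d * v x) \<and> (\<forall>(u, v)\<in>N. u x \<le> v x))"

lemma ex_solved_form:
  fixes C :: "('i, 'r::bipotent_semifield) inequality set"
  assumes "finite C" "C \<subseteq> monomials (insert i V) \<times> monomials (insert i V)"
  shows "\<exists>U L N. solved_form i V C U L N"
  using assms
proof induction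
  case empty
  have "solved_form i V ({} :: ('i, 'r) inequality set) {} {} {}"
    by (simp add: solved_form_def sols_def)
  then show ?case by blast
next
  case (insert c C)
  obtain p q where c: "c = (p, q)" by (cases c)
  with insert.prems have pq: "p \<in> monomials (insert i V)" "q \<in> monomials (insert i V)" by auto
  obtain a u where u: "u \<in> monomials V" "\<forall>x. p x = x i ^ a * u x"
    using monomials_insert[OF pq(1)] by blast
  obtain b v where v: "v \<in> monomials V" "\<forall>x. q x = x i ^ b * v x"
    using monomials_insert[OF pq(2)] by blast
  from insert.prems insert.IH obtain U L N where ULN: "solved_form i V C U L N"
    by blast
  have sol: "x \<in> sols (insert c C) \<longleftrightarrow>
      (if a < b then u x \<le> x i ^ (b - a) * v x else x i ^ (a - b) * u x \<le> v x) \<and> x \<in> sols C" for x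
    by (simp add: sols_def c u v bipotent_power_mult_le_normal_form)
  \<comment> \<open>The exponents of \<open>x i\<close> on the two sides decide whether the new
    inequality is a lower bound, an upper bound, or free of \<open>x i\<close>.\<close>
  consider "a < b" | "b < a" | "a = b" by linarith
  then show ?case
  proof cases
    case 1
    with ULN u(1) v(1) have "solved_form i V (insert c C) U (insert (b - a, u, v) L) N"
      by (simp add: solved_form_def sol conj_ac)
    then show ?thesis by blast
  next
    case 2
    with ULN u(1) v(1) have "solved_form i V (insert c C) (insert (a - b, u, v) U) L N"
      by (simp add: solved_form_def sol conj_ac)
    then show ?thesis by blast
  next
    case 3
    with ULN u(1) v(1) have "solved_form i V (insert c C) U L (insert (u, v) N)"
      by (simp add: solved_form_def sol conj_ac)
    then show ?thesis by blast
  qed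
qed

text \<open>Monomials over \<open>V\<close> ignore the new value, so the system constrains
  \<open>y\<close> alone, with the other coordinates as parameters.\<close>

lemma solved_form_update:
  assumes ULN: "solved_form i V C U L N" and i: "i \<notin> V"
  shows "x(i := y) \<in> sols C \<longleftrightarrow> (\<forall>(d, u, v)\<in>U. y ^ d * u x \<le> v x) \<and>
    (\<forall>(d, u, v)\<in>L. u x \<le> y ^ d * v x) \<and> (\<forall>(u, v)\<in>N. u x \<le> v x)"
proof -
  have U: "U \<subseteq> {1..} \<times> monomials V \<times> monomials V"
    and L: "L \<subseteq> {1..} \<times> monomials V \<times> monomials V"
    and N: "N \<subseteq> monomials V \<times> monomials V"
    and sol: "\<And>x. x \<in> sols C \<longleftrightarrow> (\<forall>(d, u, v)\<in>U. x i ^ d * u x \<le> v x) \<and>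
       (\<forall>(d, u, v)\<in>L. u x \<le> x i ^ d * v x) \<and> (\<forall>(u, v)\<in>N. u x \<le> v x)"
    using ULN by (simp_all only: solved_form_def)
  have upd: "u (x(i := y)) = u x" if "u \<in> monomials V" for u x y
    by (rule monomials_cong[OF that]) (use i in auto)
  have "(\<forall>(d, u, v)\<in>U. (x(i := y)) i ^ d * u (x(i := y)) \<le> v (x(i := y))) \<longleftrightarrow>
      (\<forall>(d, u, v)\<in>U. y ^ d * u x \<le> v x)"
    using U by (intro ball_cong) (auto simp: upd)
  moreover have "(\<forall>(d, u, v)\<in>L. u (x(i := y)) \<le> (x(i := y)) i ^ d * v (x(i := y))) \<longleftrightarrow>
      (\<forall>(d, u, v)\<in>L. u x \<le> y ^ d * v x)"
    using L by (intro ball_cong) (auto simp: upd)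
  moreover have "(\<forall>(u, v)\<in>N. u (x(i := y)) \<le> v (x(i := y))) \<longleftrightarrow> (\<forall>(u, v)\<in>N. u x \<le> v x)"
    using N by (intro ball_cong) (auto simp: upd)
  ultimately show ?thesis unfolding sol by simp
qed

section \<open>Elimination of variables\<close>

lemma ex_root_choice:
  obtains r where "\<And>d w. 1 \<le> d \<Longrightarrow> r d w ^ d = (w :: 'r::divisible_semifield)"
proof
  show "(SOME b. b ^ d = w) ^ d = w" if "1 \<le> d" for d and w :: 'r
    by (rule someI_ex) (rule ex_root[OF that])
qed

text \<open>In the power \<open>d * e\<close> the roots disappear: \<open>rl\<close> yields the
  \<open>d\<close>-th power of \<open>u' / v'\<close> and \<open>ru\<close> the \<open>e\<close>-th
  power of \<open>v / u\<close>. The last hypothesis compares these with denominators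
  cleared.\<close>

lemma root_bounds_compatible:
  fixes ru rl :: "'r::bipotent_semifield"
  assumes "1 \<le> d" "1 \<le> e" "ru ^ d = v * inverse u" "rl ^ e = u' * inverse v'"
    and "u' ^ d * u ^ e \<le> v ^ e * v' ^ d"
  shows "rl \<le> ru"
proof -
  have "rl ^ (d * e) = u' ^ d * inverse (v' ^ d)"
    unfolding mult.commute[of d e] power_mult assms(4)
    by (simp add: power_mult_distrib semifield_inverse_power)
  moreover have "ru ^ (d * e) = v ^ e * inverse (u ^ e)"
    unfolding power_mult assms(3)
    by (simp add: power_mult_distrib semifield_inverse_power)
  moreover have "u' ^ d * inverse (v' ^ d) \<le> v ^ e * inverse (u ^ e)"
  proof -
    have eq: "v ^ e * inverse (u ^ e) * v' ^ d = v ^ e * v' ^ d * inverse (u ^ e)"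
      by (simp only: ac_simps)
    show ?thesis
      unfolding bipotent_mult_inverse_le_iff eq unfolding bipotent_le_mult_inverse_iff
      by (fact assms(5))
  qed
  moreover have "1 \<le> d * e" using assms(1,2) by simp
  ultimately show ?thesis
    using bipotent_power_le_iff[of "d * e" rl ru] by simp
qed

text \<open>Every upper bound is paired with every lower bound. If all pairs are compatible, some
  \<open>y\<close> separates the finitely many lower roots from the upper ones.\<close>

lemma fourier_motzkin_step:
  fixes C :: "('i, 'r::{divisible_semifield, bipotent_semifield}) inequality set"
  assumes "finite C" "C \<subseteq> monomials (insert i V) \<times> monomials (insert i V)" "i \<notin> V"
  shows "\<exists>C'. finite C' \<and> C' \<subseteq> monomials V \<times> monomials V \<and>
    (\<forall>x. x \<in> sols C' \<longleftrightarrow> (\<exists>y. x(i := y) \<in> sols C))"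
proof -
  obtain U L N where ULN: "solved_form i V C U L N"
    using ex_solved_form[OF assms(1,2)] by blast
  then have fin: "finite U" "finite L" "finite N"
    and U: "U \<subseteq> {1..} \<times> monomials V \<times> monomials V"
    and L: "L \<subseteq> {1..} \<times> monomials V \<times> monomials V"
    and N: "N \<subseteq> monomials V \<times> monomials V"
    by (simp_all only: solved_form_def)
  \<comment> \<open>From \<open>y ^ d * u \<le> v\<close> and \<open>u' \<le> y ^ e * v'\<close>,
    raising to the powers \<open>e\<close> and \<open>d\<close> produces \<open>y ^ (d * e)\<close>
    in both, and it cancels.\<close>
  define comb where "comb = (\<lambda>((d, u, v), (e, u', v')).
    ((\<lambda>x::'i \<Rightarrow> 'r. u' x ^ d * u x ^ e :: 'r), (\<lambda>x::'i \<Rightarrow> 'r. v x ^ e * v' x ^ d :: 'r)))"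
  let ?C = "N \<union> comb ` (U \<times> L)"
  have sol': "x \<in> sols ?C \<longleftrightarrow> (\<forall>(u, v)\<in>N. u x \<le> v x) \<and>
      (\<forall>(d, u, v)\<in>U. \<forall>(e, u', v')\<in>L. u' x ^ d * u x ^ e \<le> v x ^ e * v' x ^ d)" for x
    unfolding sols_def comb_def by (simp add: ball_Un) fastforce
  note sol_upd = solved_form_update[OF ULN assms(3)]
  have "x \<in> sols ?C \<longleftrightarrow> (\<exists>y. x(i := y) \<in> sols C)" for x
  proof
    assume "x \<in> sols ?C"
    then have xN: "\<forall>(u, v)\<in>N. u x \<le> v x"
      and xUL: "\<And>d u v e u' v'. (d, u, v) \<in> U \<Longrightarrow> (e, u', v') \<in> L \<Longrightarrow>
        u' x ^ d * u x ^ e \<le> v x ^ e * v' x ^ d"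
      unfolding sol' by blast+
    obtain r where r: "\<And>d w. 1 \<le> d \<Longrightarrow> r d w ^ d = (w :: 'r)" by (rule ex_root_choice) blast
    \<comment> \<open>Solved for \<open>y\<close>, the members of \<open>U\<close> say
      \<open>y \<le> ru\<close> and, with \<open>rl\<close>, those of \<open>L\<close> say
      \<open>rl \<le> y\<close>.\<close>
    define ru where "ru = (\<lambda>(d, u, v). r d (v x * inverse (u x)))"
    define rl where "rl = (\<lambda>(d, u, v). r d (u x * inverse (v x)))"
    have "\<forall>l\<in>rl ` L. \<forall>u\<in>ru ` U. l \<le> u"
    proof (clarify)
      fix e u' v' d u v assume el: "(e, u', v') \<in> L" "(d, u, v) \<in> U"
      then have de: "1 \<le> d" "1 \<le> e" using U L by auto
      show "rl (e, u', v') \<le> ru (d, u, v)"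
        unfolding rl_def ru_def prod.case
        by (rule root_bounds_compatible[OF de r[OF de(1)] r[OF de(2)] xUL[OF el(2,1)]])
    qed
    then obtain y where y: "\<forall>l\<in>rl ` L. l \<le> y" "\<forall>u\<in>ru ` U. y \<le> u"
      using bipotent_finite_between[of "rl ` L" "ru ` U"] fin by auto
    have "y ^ d * u x \<le> v x" if "(d, u, v) \<in> U" for d u v
    proof -
      have "1 \<le> d" using that U by auto
      moreover have "y \<le> r d (v x * inverse (u x))" using y(2) that by (auto simp: ru_def)
      ultimately have "y ^ d \<le> v x * inverse (u x)"
        using bipotent_power_mono[of y "r d (v x * inverse (u x))" d] r by simp
      then show ?thesis by (simp add: bipotent_le_mult_inverse_iff)
    qed
    moreover have "u x \<le> y ^ d * v x" if "(d, u, v) \<in> L" for d u v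
    proof -
      have "1 \<le> d" using that L by auto
      moreover have "r d (u x * inverse (v x)) \<le> y" using y(1) that by (auto simp: rl_def)
      ultimately have "u x * inverse (v x) \<le> y ^ d"
        using bipotent_power_mono[of "r d (u x * inverse (v x))" y d] r by simp
      then show ?thesis by (simp add: bipotent_mult_inverse_le_iff)
    qed
    ultimately show "\<exists>y. x(i := y) \<in> sols C"
      unfolding sol_upd using xN by (intro exI[of _ y]) blast
  next
    assume "\<exists>y. x(i := y) \<in> sols C"
    then obtain y where y: "\<And>d u v. (d, u, v) \<in> U \<Longrightarrow> y ^ d * u x \<le> v x"
      "\<And>d u v. (d, u, v) \<in> L \<Longrightarrow> u x \<le> y ^ d * v x" "\<forall>(u, v)\<in>N. u x \<le> v x"
      unfolding sol_upd by blast
    have "u' x ^ d * u x ^ e \<le> v x ^ e * v' x ^ d"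
      if "(d, u, v) \<in> U" "(e, u', v') \<in> L" for d u v e u' v'
    proof -
      have "u' x ^ d * u x ^ e \<le> (y ^ e * v' x) ^ d * u x ^ e"
        using y(2)[OF that(2)] by (simp add: bipotent_power_mono)
      also have "\<dots> = v' x ^ d * (y ^ d * u x) ^ e"
        by (simp add: power_mult_distrib ac_simps flip: power_mult)
      also have "\<dots> \<le> v' x ^ d * v x ^ e"
        using y(1)[OF that(1)] by (simp add: bipotent_power_mono)
      finally show ?thesis by (simp add: mult.commute)
    qed
    with y(3) show "x \<in> sols ?C" unfolding sol' by blast
  qed
  moreover have "?C \<subseteq> monomials V \<times> monomials V"
    using U L N by (force simp: comb_def intro: monomials.mult monomials_power)
  ultimately show ?thesis using fin by (intro exI[of _ ?C]) auto
qed

lemma fourier_motzkin: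
  fixes C :: "('i, 'r::{divisible_semifield, bipotent_semifield}) inequality set"
  assumes "finite W" "W \<inter> V = {}"
    "finite C" "C \<subseteq> monomials (W \<union> V) \<times> monomials (W \<union> V)"
  shows "\<exists>C'. finite C' \<and> C' \<subseteq> monomials V \<times> monomials V \<and>
    (\<forall>x. x \<in> sols C' \<longleftrightarrow> (\<exists>x'\<in>sols C. \<forall>i. i \<notin> W \<longrightarrow> x' i = x i))"
  using assms
proof (induction arbitrary: C)
  case empty
  then show ?case by (intro exI[of _ C]) (auto simp flip: fun_eq_iff)
next
  case (insert i W)
  have "i \<notin> W \<union> V" using insert.hyps insert.prems(1) by auto
  moreover have "C \<subseteq> monomials (insert i (W \<union> V)) \<times> monomials (insert i (W \<union> V))"
    using insert.prems(3) by simp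
  ultimately have "\<exists>C1. finite C1 \<and> C1 \<subseteq> monomials (W \<union> V) \<times> monomials (W \<union> V) \<and>
      (\<forall>x. x \<in> sols C1 \<longleftrightarrow> (\<exists>y. x(i := y) \<in> sols C))"
    by (intro fourier_motzkin_step insert.prems(2))
  then obtain C1 where C1: "finite C1" "C1 \<subseteq> monomials (W \<union> V) \<times> monomials (W \<union> V)"
    "\<forall>x. x \<in> sols C1 \<longleftrightarrow> (\<exists>y. x(i := y) \<in> sols C)"
    by (elim exE conjE) (rule that)
  have "W \<inter> V = {}" using insert.prems(1) by auto
  from insert.IH[OF this C1(1,2)]
  obtain C2 where C2: "finite C2" "C2 \<subseteq> monomials V \<times> monomials V"
    "\<forall>x. x \<in> sols C2 \<longleftrightarrow> (\<exists>x'\<in>sols C1. \<forall>i. i \<notin> W \<longrightarrow> x' i = x i)"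
    by (elim exE conjE) (rule that)
  have "x \<in> sols C2 \<longleftrightarrow> (\<exists>x'\<in>sols C. \<forall>j. j \<notin> insert i W \<longrightarrow> x' j = x j)" for x
  proof
    assume "x \<in> sols C2"
    then obtain x' where x': "x' \<in> sols C1" "\<forall>i. i \<notin> W \<longrightarrow> x' i = x i"
      unfolding C2(3)[rule_format] by blast
    from x'(1) obtain y where "x'(i := y) \<in> sols C"
      unfolding C1(3)[rule_format] by blast
    with x'(2) show "\<exists>x'\<in>sols C. \<forall>j. j \<notin> insert i W \<longrightarrow> x' j = x j"
      by (intro bexI[of _ "x'(i := y)"]) auto
  next
    assume "\<exists>x'\<in>sols C. \<forall>j. j \<notin> insert i W \<longrightarrow> x' j = x j"
    then obtain x' where x': "x' \<in> sols C" "\<And>j. j \<notin> insert i W \<Longrightarrow> x' j = x j" by blast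
    \<comment> \<open>The double update is \<open>x'\<close> itself. Read as an update of
      \<open>x'(i := x i)\<close>, it makes that point a solution of \<open>C1\<close>, and that
      point agrees with \<open>x\<close> outside \<open>W\<close>.\<close>
    have "x'(i := x i, i := x' i) \<in> sols C" using x'(1) by simp
    then have "x'(i := x i) \<in> sols C1" unfolding C1(3)[rule_format] by (rule exI)
    with x'(2) show "x \<in> sols C2"
      unfolding C2(3)[rule_format] by (intro bexI[of _ "x'(i := x i)"]) auto
  qed
  with C2(1,2) show ?case by blast
qed

section \<open>Power bounds for systems in two variables\<close>

lemma solved_form_upper_tight:
  fixes C :: "('i, 'r::{divisible_semifield, bipotent_semifield}) inequality set"
  assumes C: "solved_form j V C U L N" and j: "j \<notin> V" and "1 < (\<alpha>::'r)"
    and one: "(\<lambda>_. 1) \<in> sols C"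
    and uniq: "\<And>y. (\<lambda>_. 1)(j := y) \<in> sols C \<Longrightarrow> y = 1"
  shows "\<exists>(d, u, v)\<in>U. u (\<lambda>_. 1) = v (\<lambda>_. 1)"
\<comment> \<open>Without a tight upper bound at the all-ones point, coordinate \<open>j\<close>
  could be raised above \<open>1\<close> without violating any constraint, contrary to
  \<open>uniq\<close>.\<close>
proof (rule ccontr)
  let ?o = "\<lambda>_ :: 'i. 1 :: 'r"
  assume not_tight: "\<not> ?thesis"
  have fin: "finite U"
    and U: "U \<subseteq> {1..} \<times> monomials V \<times> monomials V"
    and L: "L \<subseteq> {1..} \<times> monomials V \<times> monomials V"
    using C by (simp_all only: solved_form_def)
  note sol_upd = solved_form_update[OF C j, of ?o]
  have one': "?o(j := 1) \<in> sols C" using one by (simp add: fun_upd_idem)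
  have one: "\<And>d u v. (d, u, v) \<in> U \<Longrightarrow> u ?o \<le> v ?o"
    "\<And>d u v. (d, u, v) \<in> L \<Longrightarrow> u ?o \<le> v ?o" "\<forall>(u, v)\<in>N. u ?o \<le> v ?o"
    using one' unfolding sol_upd power_one mult_1 by blast+
  obtain r where r: "\<And>d w. 1 \<le> d \<Longrightarrow> r d w ^ d = (w :: 'r)" by (rule ex_root_choice) blast
  \<comment> \<open>The largest values of coordinate \<open>j\<close> that the individual upper
    bounds allow when all other coordinates are \<open>1\<close>.\<close>
  define R where "R = (\<lambda>(d, u, v). r d (v ?o * inverse (u ?o))) ` U"
  have R_gt: "1 < z" if "z \<in> R" for z
  proof -
    from that obtain t where "t \<in> U" "z = (\<lambda>(d, u, v). r d (v ?o * inverse (u ?o))) t"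
      unfolding R_def by (rule imageE)
    then obtain d u v where duv: "(d, u, v) \<in> U" "z = r d (v ?o * inverse (u ?o))"
      by (cases t) auto
    then have d: "1 \<le> d" using U by auto
    have z: "z ^ d * u ?o = v ?o"
      using r[OF d] duv(2) by (simp add: mult.assoc semifield_left_inverse)
    have "1 * u ?o \<le> z ^ d * u ?o" using one(1)[OF duv(1)] z by simp
    then have "1 ^ d \<le> z ^ d" unfolding bipotent_mult_le_cancel_right by simp
    then have "1 \<le> z" using bipotent_power_le_iff[OF d] by blast
    moreover have "z \<noteq> 1" using z not_tight duv(1) by auto
    ultimately show ?thesis by simp
  qed
  \<comment> \<open>Including \<open>\<alpha>\<close> makes the set nonempty even if
    \<open>U\<close> is empty; all its members exceed \<open>1\<close>, hence so does the
    minimum.\<close>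
  have "finite (insert \<alpha> R)" using fin by (simp add: R_def)
  then obtain y where y: "y \<in> insert \<alpha> R" "\<forall>z\<in>insert \<alpha> R. y \<le> z"
    using bipotent_finite_has_min[of "insert \<alpha> R"] by blast
  have "1 < y" using y(1) R_gt \<open>1 < \<alpha>\<close> by auto
  have "y ^ d * u ?o \<le> v ?o" if duv: "(d, u, v) \<in> U" for d u v
  proof -
    have d: "1 \<le> d" using U duv by auto
    have "r d (v ?o * inverse (u ?o)) \<in> insert \<alpha> R"
      unfolding R_def by (rule insertI2, rule image_eqI[OF _ duv]) simp
    with y(2) have "y \<le> r d (v ?o * inverse (u ?o))" by (rule bspec)
    then have "y ^ d \<le> v ?o * inverse (u ?o)"
      using bipotent_power_mono[of y "r d (v ?o * inverse (u ?o))" d] r[OF d] by simp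
    then show ?thesis by (simp add: bipotent_le_mult_inverse_iff)
  qed
  moreover have "u ?o \<le> y ^ d * v ?o" if duv: "(d, u, v) \<in> L" for d u v
  proof -
    have "u ?o \<le> 1 * v ?o" using one(2)[OF duv] by simp
    also have "\<dots> \<le> y ^ d * v ?o"
      unfolding bipotent_mult_le_cancel_right
      using \<open>1 < y\<close> by (intro bipotent_one_le_power) simp
    finally show ?thesis .
  qed
  ultimately have "?o(j := y) \<in> sols C" unfolding sol_upd using one(3) by blast
  with uniq \<open>1 < y\<close> show False by auto
qed

text \<open>Write \<open>s\<close> for \<open>x i\<close> and \<open>t\<close> for
  \<open>x j\<close>. If \<open>s = 1\<close> occurs, some upper bound on \<open>t\<close> is tight
  at the all-ones point, so its coefficients cancel and it reads
  \<open>t ^ d * s ^ a \<le> s ^ b\<close>. Otherwise an inequality in \<open>s\<close> alone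
  excludes \<open>s = 1\<close> and keeps a power of \<open>s\<close> above a constant greater than
  \<open>1\<close>.\<close>

lemma planar_power_bound:
  fixes C :: "('i, 'r::{divisible_semifield, archimedean_semifield}) inequality set"
  assumes C: "finite C" "C \<subseteq> monomials {i, j} \<times> monomials {i, j}" and "i \<noteq> j"
    and \<alpha>: "1 < (\<alpha>::'r)"
    and i: "\<And>x. x \<in> sols C \<Longrightarrow> 1 \<le> x i" and j: "\<And>x. x \<in> sols C \<Longrightarrow> 1 \<le> x j"
    and m: "\<And>x. x \<in> sols C \<Longrightarrow> x j \<le> m"
    and ij: "\<And>x. x \<in> sols C \<Longrightarrow> x i = 1 \<Longrightarrow> x j = 1"
  shows "\<exists>k. \<forall>x\<in>sols C. x j \<le> x i ^ k"
proof (cases "\<exists>x\<in>sols C. x i = 1")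
  case True
  let ?o = "\<lambda>_ :: 'i. 1 :: 'r"
  have C': "C \<subseteq> monomials (insert j {i}) \<times> monomials (insert j {i})"
    using C(2) by (simp add: insert_commute)
  obtain U L N where ULN: "solved_form j {i} C U L N"
    using ex_solved_form[OF C(1) C'] by blast
  from True obtain x0 where x0: "x0 \<in> sols C" "x0 i = 1" by blast
  then have "x0 j = 1" by (rule ij)
  with x0(2) have one: "?o \<in> sols C"
    by (intro sols_cong[OF C(2) _ x0(1)]) auto
  have "y = 1" if "?o(j := y) \<in> sols C" for y
    using ij[OF that] \<open>i \<noteq> j\<close> by simp
  with one have "\<exists>(d, u, v)\<in>U. u ?o = v ?o"
    using \<open>i \<noteq> j\<close> by (intro solved_form_upper_tight[OF ULN _ \<alpha>]) auto
  then obtain d u v where duv: "(d, u, v) \<in> U" "u ?o = v ?o" by blast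
  have "1 \<le> d" "u \<in> monomials {i}" "v \<in> monomials {i}"
    using ULN duv(1) unfolding solved_form_def by auto
  then obtain a b where ab: "\<And>x. u x = x i ^ a * u ?o" "\<And>x. v x = x i ^ b * v ?o"
    using monomials_singleton[of u i] monomials_singleton[of v i] by blast
  have "x j \<le> x i ^ b" if x: "x \<in> sols C" for x
  proof -
    have "x j ^ d * u x \<le> v x" using ULN duv(1) x unfolding solved_form_def by fastforce
    then have "(x j ^ d * x i ^ a) * v ?o \<le> x i ^ b * v ?o"
      unfolding ab[of x] duv(2) mult.assoc .
    then have le: "x j ^ d * x i ^ a \<le> x i ^ b"
      unfolding bipotent_mult_le_cancel_right .
    \<comment> \<open>Both coordinates are at least \<open>1\<close> and \<open>1 \<le> d\<close>,
      so dropping \<open>x i ^ a\<close> and lowering \<open>d\<close> to \<open>1\<close> can only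
      decrease the product.\<close>
    have "x j * 1 \<le> x j ^ d * x i ^ a"
      using i[OF x] j[OF x] \<open>1 \<le> d\<close>
      by (intro bipotent_mult_mono bipotent_le_power bipotent_one_le_power)
    with le show ?thesis by simp
  qed
  then show ?thesis by blast
next
  case False
  let ?o = "\<lambda>_ :: 'i. 1 :: 'r"
  have C': "C \<subseteq> monomials (insert j {i}) \<times> monomials (insert j {i})"
    using C(2) by (simp add: insert_commute)
  obtain D where D: "finite D" "D \<subseteq> monomials {i} \<times> monomials {i}"
    "\<forall>x. x \<in> sols D \<longleftrightarrow> (\<exists>y. x(j := y) \<in> sols C)"
    using fourier_motzkin_step[OF C(1) C'] \<open>i \<noteq> j\<close> by auto
  \<comment> \<open>\<open>D\<close> describes the values of \<open>x i\<close> that occur. The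
    value \<open>1\<close> does not, so some inequality of \<open>D\<close> fails at the all-ones
    point.\<close>
  have "?o \<notin> sols D"
  proof
    assume "?o \<in> sols D"
    then obtain y where "?o(j := y) \<in> sols C" using D(3) by blast
    with False \<open>i \<noteq> j\<close> show False by force
  qed
  then obtain p q where pq: "(p, q) \<in> D" "\<not> p ?o \<le> q ?o"
    by (auto simp: sols_def)
  then have "p \<in> monomials {i}" "q \<in> monomials {i}" using D(2) by auto
  then obtain a b where ab: "\<And>x. p x = x i ^ a * p ?o" "\<And>x. q x = x i ^ b * q ?o"
    using monomials_singleton[of p i] monomials_singleton[of q i] by blast
  \<comment> \<open>The ratio of the coefficients exceeds \<open>1\<close> because the inequality
    fails at the all-ones point. It bounds \<open>x i ^ b\<close> from below on all solutions, and
    some power of it reaches \<open>m\<close>.\<close>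
  define g where "g = p ?o * inverse (q ?o)"
  have "\<not> g \<le> 1" using pq(2) bipotent_mult_inverse_le_iff[of "p ?o" "q ?o" 1] by (simp add: g_def)
  then have "1 < g" by (simp only: bipotent_not_le)
  then obtain k where k: "m \<le> g ^ k" using archimedean_ex_power_ge by blast
  have "x j \<le> x i ^ (b * k)" if x: "x \<in> sols C" for x
  proof -
    have "x(j := x j) \<in> sols C" using x by simp
    then have "x \<in> sols D" using D(3) by blast
    then have "p x \<le> q x" using pq(1) by (auto simp: sols_def)
    then have "x i ^ a * p ?o \<le> x i ^ b * q ?o" unfolding ab[of x] .
    moreover have "1 * p ?o \<le> x i ^ a * p ?o"
      unfolding bipotent_mult_le_cancel_right by (rule bipotent_one_le_power[OF i[OF x]])
    ultimately have "p ?o \<le> x i ^ b * q ?o" by simp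
    then have "g \<le> x i ^ b" by (simp add: g_def bipotent_mult_inverse_le_iff)
    then have "g ^ k \<le> x i ^ (b * k)" by (simp add: power_mult bipotent_power_mono)
    with m[OF x] k show ?thesis by (meson order_trans)
  qed
  then show ?thesis by blast
qed

subsection \<open>Rational functions\<close>

lemma semifield_fraction_add:
  "a / b + c / d = (a * d + c * b) / (b * (d::'a::semifield))"
proof -
  have "a * d * (inverse b * inverse d) = a * inverse b * (d * inverse d)"
    "c * b * (inverse b * inverse d) = c * inverse d * (b * inverse b)"
    by (simp_all only: ac_simps)
  then show ?thesis
    by (simp add: semifield_divide_inverse semifield_inverse_mult distrib_right
        semifield_right_inverse)
qed

lemma semifield_fraction_mult: "a / b * (c / d) = a * c / (b * (d::'a::semifield))"
  by (simp add: semifield_divide_inverse semifield_inverse_mult ac_simps)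

lemma semifield_inverse_fraction: "inverse (a / b) = b / (a::'a::semifield)"
  by (simp add: semifield_divide_inverse semifield_inverse_mult mult.commute)

lemma rational_funs_const: "(\<lambda>_. c) \<in> rational_funs"
proof -
  have "(\<lambda>_. c) = (\<lambda>_. c) / (\<lambda>_. 1)"
    by (simp add: fun_eq_iff semifield_divide_inverse)
  then show ?thesis unfolding rational_funs_def using polynomial_funs.const by blast
qed

lemma is_subsemifield_rational_funs: "is_subsemifield rational_funs"
  unfolding is_subsemifield_def
proof (intro conjI ballI)
  show "1 \<in> rational_funs" using rational_funs_const[of 1] by (simp add: one_fun_def)
next
  fix f g :: "'a ^ 'b \<Rightarrow> 'a"
  assume "f \<in> rational_funs" "g \<in> rational_funs"
  then obtain p q p' q' where pq: "p \<in> polynomial_funs" "q \<in> polynomial_funs" "f = p / q"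
    "p' \<in> polynomial_funs" "q' \<in> polynomial_funs" "g = p' / q'"
    unfolding rational_funs_def by blast
  have "p * q' + p' * q \<in> polynomial_funs" "q * q' \<in> polynomial_funs" "p * p' \<in> polynomial_funs"
    using pq by (auto intro: polynomial_funs.intros)
  then show "f + g \<in> rational_funs" "f * g \<in> rational_funs"
    unfolding rational_funs_def pq(3,6) semifield_fraction_add semifield_fraction_mult by blast+
next
  fix f :: "'a ^ 'b \<Rightarrow> 'a"
  assume "f \<in> rational_funs"
  then obtain p q where "p \<in> polynomial_funs" "q \<in> polynomial_funs" "f = p / q"
    unfolding rational_funs_def by blast
  then show "inverse f \<in> rational_funs"
    unfolding rational_funs_def using semifield_inverse_fraction[of p q] by blast
qed

section \<open>Polynomial functions as maxima of monomials\<close>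

definition max_of_monomials ::
    "('n \<Rightarrow> 'i) \<Rightarrow> ('r::{semifield, ord} ^ 'n \<Rightarrow> 'r) \<Rightarrow> (('i \<Rightarrow> 'r) \<Rightarrow> 'r) set \<Rightarrow> bool" where
  "max_of_monomials h p M \<longleftrightarrow> finite M \<and> M \<subseteq> monomials (range h) \<and>
    (\<forall>x. (\<exists>m\<in>M. m x = p (\<chi> i. x (h i))) \<and> (\<forall>m\<in>M. m x \<le> p (\<chi> i. x (h i))))"

lemma max_of_monomials_attained:
  assumes "max_of_monomials h p M" shows "\<exists>m\<in>M. m x = p (\<chi> i. x (h i))"
  using assms unfolding max_of_monomials_def by blast

lemma max_of_monomials_upper:
  assumes "max_of_monomials h p M" "m \<in> M" shows "m x \<le> p (\<chi> i. x (h i))"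
  using assms unfolding max_of_monomials_def by blast

text \<open>Dominance of \<open>m\<close> at \<open>x\<close> is thus a finite system of monomial
  inequalities; such systems cut out the regions used below.\<close>

lemma max_of_monomials_eq_iff:
  assumes "max_of_monomials h p M" "m \<in> M"
  shows "(\<forall>n\<in>M. n x \<le> m x) \<longleftrightarrow> m x = (p (\<chi> i. x (h i)) :: 'r::bipotent_semifield)"
proof
  assume *: "\<forall>n\<in>M. n x \<le> m x"
  obtain n where "n \<in> M" "n x = p (\<chi> i. x (h i))"
    using max_of_monomials_attained[OF assms(1)] by blast
  with * have "p (\<chi> i. x (h i)) \<le> m x" by force
  then show "m x = p (\<chi> i. x (h i))" using max_of_monomials_upper[OF assms, of x] by simp
next
  assume "m x = p (\<chi> i. x (h i))"
  then show "\<forall>n\<in>M. n x \<le> m x" using max_of_monomials_upper[OF assms(1)] by simp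
qed

text \<open>Addition is the maximum, so a sum takes the union of the two sets; multiplication is
  monotone, so a product takes all pairwise products.\<close>

lemma polynomial_funs_max_of_monomials:
  fixes p :: "'r::bipotent_semifield ^ 'n \<Rightarrow> 'r"
  assumes "p \<in> polynomial_funs"
  shows "\<exists>M. max_of_monomials h p M"
  using assms
proof induction
  case (const c)
  show ?case
    by (rule exI[of _ "{\<lambda>_. c}"]) (simp add: max_of_monomials_def monomials.const)
next
  case (var i)
  show ?case
    by (rule exI[of _ "{\<lambda>x. x (h i)}"]) (simp add: max_of_monomials_def monomials.var)
next
  case (add p q)
  then obtain M N where M: "max_of_monomials h p M" and N: "max_of_monomials h q N" by blast
  have "\<exists>m\<in>M \<union> N. m x = (p + q) (\<chi> i. x (h i))" for x
    using bipotent[of "p (\<chi> i. x (h i))" "q (\<chi> i. x (h i))"]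
      max_of_monomials_attained[OF M, of x] max_of_monomials_attained[OF N, of x] by auto
  moreover have "m x \<le> (p + q) (\<chi> i. x (h i))" if "m \<in> M \<union> N" for m x
    using that
  proof
    assume "m \<in> M"
    from order_trans[OF max_of_monomials_upper[OF M this] bipotent_le_add(1)]
    show ?thesis by simp
  next
    assume "m \<in> N"
    from order_trans[OF max_of_monomials_upper[OF N this] bipotent_le_add(2)]
    show ?thesis by simp
  qed
  ultimately have "max_of_monomials h (p + q) (M \<union> N)"
    using M N unfolding max_of_monomials_def by simp
  then show ?case by blast
next
  case (mult p q)
  then obtain M N where M: "max_of_monomials h p M" and N: "max_of_monomials h q N" by blast
  let ?P = "{\<lambda>x. m x * n x |m n. m \<in> M \<and> n \<in> N}"
  have "\<exists>m\<in>?P. m x = (p * q) (\<chi> i. x (h i))" for x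
  proof -
    obtain m n where mn: "m \<in> M" "m x = p (\<chi> i. x (h i))" "n \<in> N" "n x = q (\<chi> i. x (h i))"
      using max_of_monomials_attained[OF M, of x] max_of_monomials_attained[OF N, of x] by blast
    then have "(\<lambda>x. m x * n x) \<in> ?P" by blast
    with mn(2,4) show ?thesis by (intro bexI[of _ "\<lambda>x. m x * n x"]) simp_all
  qed
  moreover have "m x \<le> (p * q) (\<chi> i. x (h i))" if m: "m \<in> ?P" for m x
  proof -
    obtain a b where "a \<in> M" "b \<in> N" "m = (\<lambda>x. a x * b x)" using m by blast
    then show ?thesis
      using bipotent_mult_mono[OF max_of_monomials_upper[OF M] max_of_monomials_upper[OF N], of a b x x]
      by simp
  qed
  moreover have "?P \<subseteq> monomials (range h)"
    using M N unfolding max_of_monomials_def by (auto intro: monomials.mult)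
  moreover have "finite ?P"
    using M N by (intro finite_image_set2) (simp_all add: max_of_monomials_def)
  ultimately have "max_of_monomials h (p * q) ?P"
    unfolding max_of_monomials_def by simp
  then show ?case by blast
qed

section \<open>The power bound for rational functions\<close>

lemma uniform_exponent:
  fixes f g :: "'x \<Rightarrow> 'r::bipotent_semifield"
  assumes "finite I" "\<And>i. i \<in> I \<Longrightarrow> \<exists>k. \<forall>v\<in>P i. g v \<le> f v ^ k" "\<And>v. 1 \<le> f v"
  shows "\<exists>k. \<forall>i\<in>I. \<forall>v\<in>P i. g v \<le> f v ^ k"
  using assms(1,2)
proof induction
  case (insert i I)
  obtain k where k: "\<forall>v\<in>P i. g v \<le> f v ^ k" using insert.prems by blast
  obtain l where l: "\<forall>i\<in>I. \<forall>v\<in>P i. g v \<le> f v ^ l" using insert by blast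
  \<comment> \<open>Powers of \<open>f v\<close> grow with the exponent, so \<open>k + l\<close>
    serves the new region and the old ones alike.\<close>
  have "f v ^ k \<le> f v ^ (k + l)" "f v ^ l \<le> f v ^ (k + l)" for v
    by (simp_all add: bipotent_power_increasing assms(3))
  with k l have "\<forall>j\<in>insert i I. \<forall>v\<in>P j. g v \<le> f v ^ (k + l)"
    by (blast intro: order_trans)
  then show ?case by blast
qed simp

lemma rational_funs_power_bound:
  fixes f g :: "'r::{divisible_semifield, archimedean_semifield} ^ 'n \<Rightarrow> 'r"
  assumes fg: "f \<in> rational_funs" "g \<in> rational_funs" and \<alpha>: "1 < (\<alpha>::'r)"
    and f1: "\<And>v. 1 \<le> f v" and g1: "\<And>v. 1 \<le> g v" and gm: "\<And>v. g v \<le> m"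
    and zero: "\<And>v. f v = 1 \<Longrightarrow> g v = 1"
  shows "\<exists>k. \<forall>v. g v \<le> f v ^ k"
proof -
  let ?vec = "\<lambda>x :: 'n + bool \<Rightarrow> 'r. \<chi> i. x (Inl i)"
  \<comment> \<open>The index type \<open>'n + bool\<close> holds the coordinates of a vector on the
    left and has room for the two values \<open>f v\<close> and \<open>g v\<close> on the
    right.\<close>
  let ?s = "Inr False :: 'n + bool" and ?t = "Inr True :: 'n + bool"
  let ?W = "range Inl :: ('n + bool) set"
  obtain p q p' q' where pq: "p \<in> polynomial_funs" "q \<in> polynomial_funs" "f = p / q"
    "p' \<in> polynomial_funs" "q' \<in> polynomial_funs" "g = p' / q'"
    using fg unfolding rational_funs_def by blast
  have fpq: "s * q v = p v \<longleftrightarrow> s = f v" and gpq: "s * q' v = p' v \<longleftrightarrow> s = g v" for s v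
  proof -
    have "f v * q v = p v" "g v * q' v = p' v"
      unfolding pq(3,6) by (simp_all add: semifield_divide_inverse mult.assoc semifield_left_inverse)
    then show "s * q v = p v \<longleftrightarrow> s = f v" "s * q' v = p' v \<longleftrightarrow> s = g v"
      using semifield_mult_right_cancel[of s "q v" "f v"]
        semifield_mult_right_cancel[of s "q' v" "g v"] by simp_all
  qed
  let ?inl = "Inl :: 'n \<Rightarrow> 'n + bool"
  obtain Mp Mq Np Nq where M: "max_of_monomials ?inl p Mp" "max_of_monomials ?inl q Mq"
    "max_of_monomials ?inl p' Np" "max_of_monomials ?inl q' Nq"
    using polynomial_funs_max_of_monomials pq by meson
  note tops = M[THEN max_of_monomials_eq_iff]
  \<comment> \<open>The first four sets make \<open>a\<close>, \<open>b\<close>, \<open>c\<close>,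
    \<open>d\<close> dominant in \<open>p\<close>, \<open>q\<close>, \<open>p'\<close>,
    \<open>q'\<close>. The last encodes \<open>s * b = a\<close> and \<open>t * d = c\<close>, each
    as two inequalities, which then say \<open>s = f v\<close> and \<open>t = g v\<close> without
    division.\<close>
  define reg where "reg = (\<lambda>(a :: ('n + bool \<Rightarrow> 'r) \<Rightarrow> 'r, b, c, d).
    (\<lambda>n. (n, a)) ` Mp \<union> (\<lambda>n. (n, b)) ` Mq \<union> (\<lambda>n. (n, c)) ` Np \<union> (\<lambda>n. (n, d)) ` Nq \<union>
    {(\<lambda>x. x ?s * b x, a), (a, \<lambda>x. x ?s * b x), (\<lambda>x. x ?t * d x, c), (c, \<lambda>x. x ?t * d x)})"
  have reg: "x \<in> sols (reg (a, b, c, d)) \<longleftrightarrow>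
      a x = p (?vec x) \<and> b x = q (?vec x) \<and> c x = p' (?vec x) \<and> d x = q' (?vec x) \<and>
      x ?s = f (?vec x) \<and> x ?t = g (?vec x)"
    if abcd: "a \<in> Mp" "b \<in> Mq" "c \<in> Np" "d \<in> Nq" for x a b c d
  proof -
    have "x \<in> sols (reg (a, b, c, d)) \<longleftrightarrow>
      (\<forall>n\<in>Mp. n x \<le> a x) \<and> (\<forall>n\<in>Mq. n x \<le> b x) \<and> (\<forall>n\<in>Np. n x \<le> c x) \<and> (\<forall>n\<in>Nq. n x \<le> d x) \<and>
      x ?s * b x = a x \<and> x ?t * d x = c x"
      unfolding sols_def reg_def by (simp add: ball_Un eq_iff conj_ac)
    then show ?thesis
      unfolding tops(1)[OF abcd(1)] tops(2)[OF abcd(2)] tops(3)[OF abcd(3)] tops(4)[OF abcd(4)]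
      using fpq[of "x ?s" "?vec x"] gpq[of "x ?t" "?vec x"] by auto
  qed
  define I where "I = Mp \<times> Mq \<times> Np \<times> Nq"
  \<comment> \<open>The point of the graph of \<open>(f, g)\<close> above \<open>v\<close>.\<close>
  define lift where "lift = (\<lambda>v :: 'r ^ 'n. case_sum (($) v) (\<lambda>b. if b then g v else f v))"
  have vec_lift: "?vec (lift v) = v" for v by (simp add: lift_def vec_eq_iff)
  define P where "P = (\<lambda>r. {v. lift v \<in> sols (reg r)})"
  have "\<exists>k. \<forall>v\<in>P r. g v \<le> f v ^ k" if "r \<in> I" for r
  proof -
    obtain a b c d where r: "r = (a, b, c, d)" by (cases r)
    with that have abcd: "a \<in> Mp" "b \<in> Mq" "c \<in> Np" "d \<in> Nq" by (auto simp: I_def)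
    let ?C = "reg (a, b, c, d)"
    have W: "UNIV = ?W \<union> {?s, ?t}"
    proof (intro equalityI subsetI)
      fix z :: "'n + bool"
      show "z \<in> ?W \<union> {?s, ?t}" by (cases z) auto
    qed simp
    have "finite ?C" using M by (simp add: reg_def max_of_monomials_def)
    moreover have "?C \<subseteq> monomials (?W \<union> {?s, ?t}) \<times> monomials (?W \<union> {?s, ?t})"
    proof -
      have mono: "n \<in> monomials UNIV" if "n \<in> Mp \<union> Mq \<union> Np \<union> Nq" for n
        using that M monomials_mono[of n ?W UNIV] unfolding max_of_monomials_def by blast
      then show ?thesis
        using abcd unfolding W[symmetric] reg_def
        by (auto intro!: monomials.mult monomials.var)
    qed
    ultimately obtain D where D: "finite D" "D \<subseteq> monomials {?s, ?t} \<times> monomials {?s, ?t}"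
      "\<forall>x. x \<in> sols D \<longleftrightarrow> (\<exists>x'\<in>sols ?C. \<forall>i. i \<notin> ?W \<longrightarrow> x' i = x i)"
      using fourier_motzkin[of ?W "{?s, ?t}" ?C] by auto
    \<comment> \<open>After the coordinates of \<open>v\<close> are eliminated, only pairs attained
      by \<open>f\<close> and \<open>g\<close> at a common point remain, so the hypotheses on
      \<open>f\<close> and \<open>g\<close> carry over to \<open>D\<close>.\<close>
    have sD: "\<exists>v. x ?s = f v \<and> x ?t = g v" if x: "x \<in> sols D" for x
    proof -
      obtain x' where x': "x' \<in> sols ?C" "\<forall>i. i \<notin> ?W \<longrightarrow> x' i = x i" using D(3) x by blast
      then have "x' ?s = x ?s" "x' ?t = x ?t" by auto
      with x'(1) show ?thesis unfolding reg[OF abcd] by auto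
    qed
    have "\<exists>k. \<forall>x\<in>sols D. x ?t \<le> x ?s ^ k"
    proof (rule planar_power_bound[OF D(1,2) _ \<alpha>])
      fix x assume "x \<in> sols D"
      with sD obtain v where v: "x ?s = f v" "x ?t = g v" by blast
      show "1 \<le> x ?s" "1 \<le> x ?t" "x ?t \<le> m" using v f1 g1 gm by simp_all
      show "x ?s = 1 \<Longrightarrow> x ?t = 1" using v zero by simp
    qed simp
    then obtain k where k: "\<And>x. x \<in> sols D \<Longrightarrow> x ?t \<le> x ?s ^ k" by blast
    have "g v \<le> f v ^ k" if v: "v \<in> P r" for v
    proof -
      have "lift v \<in> sols D" unfolding D(3)[rule_format] using v by (auto simp: P_def r)
      from k[OF this] show ?thesis by (simp add: lift_def)
    qed
    then show ?thesis by blast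
  qed
  moreover have "finite I" using M by (simp add: I_def max_of_monomials_def)
  ultimately obtain k where k: "\<forall>r\<in>I. \<forall>v\<in>P r. g v \<le> f v ^ k"
    using uniform_exponent[of I P g f] f1 by blast
  have "g v \<le> f v ^ k" for v
  proof -
    \<comment> \<open>Each of the four polynomials has a dominant monomial at \<open>v\<close>, so
      the regions cover the whole space.\<close>
    obtain a b c d where abcd: "a \<in> Mp" "b \<in> Mq" "c \<in> Np" "d \<in> Nq"
      "a (lift v) = p v" "b (lift v) = q v" "c (lift v) = p' v" "d (lift v) = q' v"
      using M[THEN max_of_monomials_attained, of "lift v"] unfolding vec_lift by blast
    have "lift v \<in> sols (reg (a, b, c, d))"
      unfolding reg[OF abcd(1-4)] vec_lift using abcd(5-8) by (simp add: lift_def)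
    with k abcd(1-4) show ?thesis by (auto simp: I_def P_def)
  qed
  then show ?thesis by blast
qed

subsection \<open>The correspondence\<close>

text \<open>In the archimedean case with \<open>\<alpha> \<noteq> 1\<close>, every constant lies
  below a power of \<open>absv \<alpha>\<close>, so these are the rational functions whose absolute
  value is bounded.\<close>

lemma constant_kernel_eq:
  fixes \<alpha> :: "'r::bipotent_semifield"
  shows "constant_kernel \<alpha> =
    {g \<in> rational_funs :: ('r ^ 'n \<Rightarrow> 'r) set. \<exists>k. \<forall>v. absv (g v) \<le> absv \<alpha> ^ k}"
  unfolding constant_kernel_def
  by (rule generated_kernel_singleton[OF is_subsemifield_rational_funs rational_funs_const])

text \<open>Closure under addition comes from idempotence: as \<open>1 + 1 = 1\<close>, the sum
  \<open>f + g\<close> is a convex combination with weights \<open>1\<close> and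
  \<open>1\<close>.\<close>

lemma is_subsemifield_constant_kernel:
  fixes \<alpha> :: "'r::bipotent_semifield"
  shows "is_subsemifield (constant_kernel \<alpha> :: ('r ^ 'n \<Rightarrow> 'r) set)"
proof -
  let ?K = "constant_kernel \<alpha> :: ('r ^ 'n \<Rightarrow> 'r) set"
  have "is_kernel rational_funs ?K"
    unfolding constant_kernel_eq by (rule is_kernel_absv_bounded[OF is_subsemifield_rational_funs])
  moreover have "f + g \<in> ?K" if fg: "f \<in> ?K" "g \<in> ?K" for f g
  proof -
    have "1 \<in> (rational_funs :: ('r ^ 'n \<Rightarrow> 'r) set)"
      using is_subsemifield_rational_funs unfolding is_subsemifield_def by blast
    moreover have "(1 :: 'r ^ 'n \<Rightarrow> 'r) + 1 = 1" by (simp add: fun_eq_iff)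
    ultimately have "1 * f + 1 * g \<in> ?K"
      using \<open>is_kernel rational_funs ?K\<close> fg unfolding is_kernel_def by blast
    then show ?thesis by simp
  qed
  ultimately show ?thesis by (simp add: is_kernel_def is_subsemifield_def)
qed

text \<open>Elements of the kernel are bounded by powers of \<open>absv f\<close>, which equal
  \<open>1\<close> wherever \<open>f\<close> does.\<close>

lemma Skel_generated_kernel:
  fixes f :: "'r::bipotent_semifield ^ 'n \<Rightarrow> 'r"
  assumes "is_subsemifield S" "f \<in> S"
  shows "Skel (generated_kernel S {f}) = Skel {f}"
proof -
  have "g a = 1" if "absv (g a) \<le> absv (f a) ^ k" "f a = 1" for g :: "'r ^ 'n \<Rightarrow> 'r" and a k
    using that absv_le_one_iff[of "g a"] absv_eq_one_iff[of "f a"] by simp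
  moreover have "f \<in> generated_kernel S {f}" by (auto simp: generated_kernel_def)
  ultimately show ?thesis
    unfolding generated_kernel_singleton[OF assms] Skel_def by blast
qed

text \<open>A Nullstellensatz: being \<open>1\<close> on the skeleton of \<open>f\<close> implies a
  bound by a power of \<open>absv f\<close> through \<open>rational_funs_power_bound\<close>, whose
  boundedness hypothesis is supplied by membership in the constant kernel.\<close>

lemma Ker_Skel_singleton:
  fixes \<alpha> :: "'r::{divisible_semifield, archimedean_semifield}"
    and f :: "'r ^ 'n \<Rightarrow> 'r"
  assumes "\<alpha> \<noteq> 1" "f \<in> constant_kernel \<alpha>"
  shows "Ker (constant_kernel \<alpha>) (Skel {f}) = generated_kernel (constant_kernel \<alpha>) {f}"
proof -
  have S: "is_subsemifield (constant_kernel \<alpha> :: ('r ^ 'n \<Rightarrow> 'r) set)"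
    by (rule is_subsemifield_constant_kernel)
  have abs_rat: "(\<lambda>v. absv (g v)) \<in> rational_funs" if "g \<in> constant_kernel \<alpha>"
    for g :: "'r ^ 'n \<Rightarrow> 'r"
  proof -
    have "g + inverse g \<in> rational_funs"
      using that is_subsemifield_rational_funs
      unfolding constant_kernel_eq is_subsemifield_def by blast
    moreover have "g + inverse g = (\<lambda>v. absv (g v))" by (simp add: fun_eq_iff absv_def)
    ultimately show ?thesis by simp
  qed
  have "(\<exists>k. \<forall>v. absv (g v) \<le> absv (f v) ^ k) \<longleftrightarrow> (\<forall>v\<in>Skel {f}. g v = 1)"
    if g: "g \<in> constant_kernel \<alpha>" for g
  proof
    assume "\<exists>k. \<forall>v. absv (g v) \<le> absv (f v) ^ k"
    then obtain k where k: "\<And>v. absv (g v) \<le> absv (f v) ^ k" by blast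
    show "\<forall>v\<in>Skel {f}. g v = 1"
    proof
      fix v assume "v \<in> Skel {f}"
      then show "g v = 1"
        using k[of v] absv_le_one_iff[of "g v"] absv_eq_one_iff[of "f v"] by (simp add: Skel_def)
    qed
  next
    assume zero: "\<forall>v\<in>Skel {f}. g v = 1"
    obtain k where k: "\<And>v. absv (g v) \<le> absv \<alpha> ^ k"
      using g by (auto simp: constant_kernel_eq)
    show "\<exists>k. \<forall>v. absv (g v) \<le> absv (f v) ^ k"
    proof (rule rational_funs_power_bound[OF abs_rat[OF assms(2)] abs_rat[OF g]])
      show "1 < absv \<alpha>" using assms(1) by (rule one_less_absv)
      show "absv (g v) \<le> absv \<alpha> ^ k" for v by (rule k)
      show "absv (g v) = 1" if "absv (f v) = 1" for v
        using zero that by (simp add: absv_eq_one_iff Skel_def)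
    qed (rule one_le_absv)+
  qed
  then show ?thesis
    unfolding generated_kernel_singleton[OF S assms(2)] Ker_def by blast
qed

text \<open>This moves the defining function of a principal skeleton into the constant kernel, so
  that \<open>Ker_Skel_singleton\<close> applies to every principal skeleton.\<close>

lemma Skel_singleton_bounded:
  fixes \<alpha> :: "'r::bipotent_semifield" and f :: "'r ^ 'n \<Rightarrow> 'r"
  assumes "\<alpha> \<noteq> 1" "f \<in> rational_funs"
  shows "\<exists>g\<in>constant_kernel \<alpha>. Skel {g} = Skel {f}"
proof -
  \<comment> \<open>\<open>g\<close> is the minimum of \<open>\<bar>f\<bar>\<close> and \<open>\<bar>\<alpha>\<bar>\<close>.\<close>
  define g where "g = inverse (inverse (f + inverse f) + (\<lambda>_. inverse (absv \<alpha>)))"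
  have g: "g v = inverse (inverse (absv (f v)) + inverse (absv \<alpha>))" for v
    by (simp add: g_def absv_def)
  have "g \<in> rational_funs"
    using assms(2) rational_funs_const is_subsemifield_rational_funs
    unfolding g_def is_subsemifield_def by blast
  have g_cases: "g v = absv (f v) \<and> absv (f v) \<le> absv \<alpha> \<or>
      g v = absv \<alpha> \<and> absv \<alpha> \<le> absv (f v)" for v
  proof (cases "absv (f v) \<le> absv \<alpha>")
    case True
    then have "inverse (absv \<alpha>) \<le> inverse (absv (f v))" by (simp add: bipotent_inverse_le_iff)
    with True show ?thesis by (simp add: g le_iff_add_eq add.commute)
  next
    case False
    then have "absv \<alpha> \<le> absv (f v)" using bipotent_total by blast
    then have "inverse (absv (f v)) \<le> inverse (absv \<alpha>)" by (simp add: bipotent_inverse_le_iff)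
    with \<open>absv \<alpha> \<le> absv (f v)\<close> show ?thesis by (simp add: g le_iff_add_eq)
  qed
  have "absv (g v) \<le> absv \<alpha> ^ 1" for v
  proof -
    have "1 \<le> g v" "g v \<le> absv \<alpha>" using g_cases[of v] one_le_absv by auto
    moreover have "1 * 1 \<le> g v * absv \<alpha>"
      using \<open>1 \<le> g v\<close> one_le_absv by (rule bipotent_mult_mono)
    ultimately show ?thesis by (simp add: absv_le_iff)
  qed
  with \<open>g \<in> rational_funs\<close> have "g \<in> constant_kernel \<alpha>" unfolding constant_kernel_eq by blast
  \<comment> \<open>Where \<open>g v = absv \<alpha>\<close>, neither side holds, because
    \<open>absv \<alpha>\<close> exceeds \<open>1\<close> and is at most
    \<open>absv (f v)\<close>.\<close>
  moreover have "g v = 1 \<longleftrightarrow> f v = 1" for v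
    using g_cases[of v] assms(1) absv_eq_one_iff[of "f v"] absv_eq_one_iff[of \<alpha>]
      absv_le_one_iff[of \<alpha>] by auto
  then have "Skel {g} = Skel {f}" by (simp add: Skel_def)
  ultimately show ?thesis by blast
qed

theorem corollary0p7p0p15:
  fixes \<alpha> :: "'r :: {divisible_semifield, archimedean_semifield, conditionally_complete_lattice}"
    and R :: "('r ^ 'n \<Rightarrow> 'r) set"
  assumes "\<alpha> \<noteq> 1"
  defines "R \<equiv> constant_kernel \<alpha>"
  shows "bij_betw (Ker R) principal_skeletons (principal_kernels R) \<and>
         bij_betw Skel (principal_kernels R) principal_skeletons \<and>
         (\<forall>Z\<in>principal_skeletons. Skel (Ker R Z) = Z) \<and>
         (\<forall>K\<in>principal_kernels R. Ker R (Skel K) = K) \<and>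
         (\<forall>Z\<in>principal_skeletons. \<forall>Z'\<in>principal_skeletons. Z \<subseteq> Z' \<longleftrightarrow> Ker R Z' \<subseteq> Ker R Z)"
proof -
  \<comment> \<open>On a generator \<open>f\<close> in \<open>R\<close> both maps are explicit: the
    kernel of \<open>f\<close> goes to the skeleton of \<open>f\<close> and back, so the two maps
    are mutually inverse.\<close>
  have Skel_gen: "Skel (generated_kernel R {f}) = Skel {f}" if "f \<in> R" for f
    using Skel_generated_kernel[OF is_subsemifield_constant_kernel] that unfolding R_def by blast
  have Ker_Skel: "Ker R (Skel {f}) = generated_kernel R {f}" if "f \<in> R" for f
    using Ker_Skel_singleton[OF assms(1)] that unfolding R_def by blast
  have skel_ex: "\<exists>f\<in>R. Z = Skel {f}" if "Z \<in> principal_skeletons" for Z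
    using that Skel_singleton_bounded[OF assms(1)]
    unfolding principal_skeletons_def R_def by blast
  have skel: "Skel {f} \<in> principal_skeletons" if "f \<in> R" for f
    using that by (auto simp: principal_skeletons_def R_def constant_kernel_eq)
  have SK: "Skel (Ker R Z) = Z" and K: "Ker R Z \<in> principal_kernels R"
    if Z: "Z \<in> principal_skeletons" for Z
  proof -
    obtain f where f: "f \<in> R" "Z = Skel {f}" using skel_ex[OF Z] by blast
    show "Skel (Ker R Z) = Z" using f Skel_gen Ker_Skel by simp
    show "Ker R Z \<in> principal_kernels R" using f Ker_Skel by (auto simp: principal_kernels_def)
  qed
  have KS: "Ker R (Skel K) = K" and S: "Skel K \<in> principal_skeletons"
    if K: "K \<in> principal_kernels R" for K
  proof -
    obtain f where f: "f \<in> R" "K = generated_kernel R {f}"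
      using K unfolding principal_kernels_def by blast
    show "Ker R (Skel K) = K" using f Skel_gen Ker_Skel by simp
    show "Skel K \<in> principal_skeletons" using f Skel_gen skel by simp
  qed
  have "bij_betw (Ker R) principal_skeletons (principal_kernels R)"
    by (rule bij_betw_byWitness[of _ Skel]) (use SK K KS S in auto)
  moreover have "bij_betw Skel (principal_kernels R) principal_skeletons"
    by (rule bij_betw_byWitness[of _ "Ker R"]) (use SK K KS S in auto)
  moreover have "Z \<subseteq> Z' \<longleftrightarrow> Ker R Z' \<subseteq> Ker R Z"
    if "Z \<in> principal_skeletons" "Z' \<in> principal_skeletons" for Z Z'
  proof
    show "Z \<subseteq> Z' \<Longrightarrow> Ker R Z' \<subseteq> Ker R Z" by (auto simp: Ker_def)
    \<comment> \<open>Applying the order-reversing \<open>Skel\<close> to both kernels returns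
      \<open>Z\<close> and \<open>Z'\<close> by \<open>SK\<close>.\<close>
    assume "Ker R Z' \<subseteq> Ker R Z"
    then have "Skel (Ker R Z) \<subseteq> Skel (Ker R Z')" by (auto simp: Skel_def)
    then show "Z \<subseteq> Z'" using SK that by simp
  qed
  ultimately show ?thesis using SK KS by blast
qed

end
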